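(* For every $n\in\mathbb{N}$, if the principal prefix of $\beta(n)$ has length $r$ and $\beta(n)$ has $s$ ones, then $$h_q(n)=q^{r+s}\,\mathrm{rgf}_n(q^{-1}).$$
   Context: $h_q(n)=\sum_\eta q^{\ell(\eta)}$ over hyperbinary partitions $\eta$ of $n$ (partitions into powers of $2$, each part used at most twice), $\ell(\eta)$ = number of parts. $\beta(n)=b_1\cdots b_k$ is the binary expansion of $n$, most significant digit first ($\beta(0)$ is the empty word). The principal prefix of $\beta(n)$ is $b_1\cdots b_r$ where $b_{r+1}$ is the rightmost $0$ of $\beta(n)$ (empty, $r=0$, if there is no $0$). The fence $\mathcal{F}(n)$ is the poset on $\{x_1,\dots,x_r\}$ whose covers are, for $2\le i\le r$: $x_i$ covered by $x_{i-1}$ if $b_i=0$, and $x_i$ covers $x_{i-1}$ if $b_i=1$. $\mathcal{J}(\mathcal{F}(n))$ is the set of lower order ideals of $\mathcal{F}(n)$, and $\mathrm{rgf}_n(t)=\sum_{I\in\mathcal{J}(\mathcal{F}(n))}t^{|I|}$. *)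

theory Defs
  imports Main "HOL-Library.Multiset" "HOL-Computational_Algebra.Formal_Laurent_Series"
begin

definition hyperbinary_partitions :: "nat \<Rightarrow> nat multiset set" where
  "hyperbinary_partitions n =
     {\<eta>. (\<forall>p\<in>#\<eta>. \<exists>k. p = 2 ^ k) \<and> (\<forall>p. count \<eta> p \<le> 2) \<and> sum_mset \<eta> = n}"

text \<open>
  The generating functions below are written as sums over an arbitrary commutative semiring.
  The identity between formal expressions in an indeterminate is obtained by evaluating at
  \<open>fls_X\<close> and its inverse \<open>fls_X_inv\<close>.
\<close>

definition hyperbinary_gf :: "'a::comm_semiring_1 \<Rightarrow> nat \<Rightarrow> 'a" where
  "hyperbinary_gf q n = (\<Sum>\<eta>\<in>hyperbinary_partitions n. q ^ size \<eta>)"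

fun binary_word :: "nat \<Rightarrow> nat list" where
  "binary_word n = (if n = 0 then [] else binary_word (n div 2) @ [n mod 2])"

declare binary_word.simps [simp del]

text \<open>
  List positions count from 0, so the 0-based position of the rightmost 0 is the length of the
  part of the word strictly before it.
\<close>

definition principal_prefix :: "nat list \<Rightarrow> nat list" where
  "principal_prefix w =
     (if 0 \<in> set w then take (Max {j. j < length w \<and> w ! j = 0}) w else [])"

text \<open>
  The element \<open>x\<^sub>i\<close> of the fence is represented by its index \<open>i\<close>, and the digit
  \<open>b\<^sub>i\<close> is \<open>binary_word n ! (i - 1)\<close>. A pair \<open>(x, y)\<close> in
  \<open>fence_covers n\<close> means that \<open>x\<close> is covered by \<open>y\<close>.
\<close>

definition fence_carrier :: "nat \<Rightarrow> nat set" where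
  "fence_carrier n = {1..length (principal_prefix (binary_word n))}"

definition fence_covers :: "nat \<Rightarrow> (nat \<times> nat) set" where
  "fence_covers n =
     {(i, i - 1) | i. 2 \<le> i \<and> i \<in> fence_carrier n \<and> binary_word n ! (i - 1) = 0} \<union>
     {(i - 1, i) | i. 2 \<le> i \<and> i \<in> fence_carrier n \<and> binary_word n ! (i - 1) = 1}"

definition fence_le :: "nat \<Rightarrow> (nat \<times> nat) set" where
  "fence_le n = (fence_covers n)\<^sup>* \<inter> fence_carrier n \<times> fence_carrier n"

definition lower_order_ideals :: "'a set \<Rightarrow> ('a \<times> 'a) set \<Rightarrow> 'a set set" where
  "lower_order_ideals A r = {I. I \<subseteq> A \<and> (\<forall>y\<in>I. \<forall>x\<in>A. (x, y) \<in> r \<longrightarrow> x \<in> I)}"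

definition rgf :: "nat \<Rightarrow> 'a::comm_semiring_1 \<Rightarrow> 'a" where
  "rgf n t = (\<Sum>I\<in>lower_order_ideals (fence_carrier n) (fence_le n). t ^ card I)"


text \<open>The index sets of both sums are finite.\<close>

lemma finite_hyperbinary_partitions: "finite (hyperbinary_partitions n)"
proof (rule finite_subset)
  let ?B = "mset ` {ps. set ps \<subseteq> {..n} \<and> length ps \<le> n}"
  show "hyperbinary_partitions n \<subseteq> ?B"
  proof
    fix \<eta> assume "\<eta> \<in> hyperbinary_partitions n"
    then have p: "\<forall>p\<in>#\<eta>. \<exists>k. p = 2 ^ k" and s: "sum_mset \<eta> = n"
      by (auto simp: hyperbinary_partitions_def)
    have pos: "\<forall>p\<in>#\<eta>. 1 \<le> p" using p by fastforce
    have "size \<eta> \<le> sum_mset \<eta>" using pos by (induction \<eta>) auto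
    moreover have "p \<le> n" if "p \<in># \<eta>" for p
      using that s by (metis le_add1 insert_DiffM sum_mset.add_mset)
    moreover obtain ps where "\<eta> = mset ps" by (metis ex_mset)
    ultimately show "\<eta> \<in> ?B" using s by auto
  qed
  show "finite ?B"
    by (intro finite_imageI finite_lists_length_le finite_atMost)
qed

lemma finite_lower_order_ideals: "finite A \<Longrightarrow> finite (lower_order_ideals A r)"
  by (rule finite_subset[of _ "Pow A"]) (auto simp: lower_order_ideals_def)

text \<open>
  \<open>fence_le n\<close> is a partial order, and its cover relation is exactly \<open>fence_covers n\<close>.
\<close>

lemma fence_covers_adjacent: "(x, y) \<in> fence_covers n \<Longrightarrow> y = Suc x \<or> x = Suc y"
  by (auto simp: fence_covers_def)

lemma fence_covers_carrier:
  "(x, y) \<in> fence_covers n \<Longrightarrow> x \<in> fence_carrier n \<and> y \<in> fence_carrier n"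
  by (auto simp: fence_covers_def fence_carrier_def)

lemma fence_covers_asym: "(x, y) \<in> fence_covers n \<Longrightarrow> (y, x) \<notin> fence_covers n"
  by (auto simp: fence_covers_def)

lemma fence_covers_rtrancl:
  assumes "(x, y) \<in> (fence_covers n)\<^sup>*"
  shows "(\<forall>k. x \<le> k \<and> k < y \<longrightarrow> (k, Suc k) \<in> fence_covers n) \<and>
         (\<forall>k. y \<le> k \<and> k < x \<longrightarrow> (Suc k, k) \<in> fence_covers n)"
  using assms
proof (induction rule: rtrancl_induct)
  case base
  then show ?case by auto
next
  case (step y z)
  consider "z = Suc y" | "y = Suc z" using fence_covers_adjacent[OF step(2)] by blast
  then show ?case
  proof cases
    case 1
    have "\<not> y < x" using step fence_covers_asym 1 by blast
    then show ?thesis using 1 step by (auto simp: less_Suc_eq)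
  next
    case 2
    have "\<not> x < y"
    proof
      assume "x < y"
      then have "(z, Suc z) \<in> fence_covers n" using step 2 by auto
      then show False using step(2) 2 fence_covers_asym by blast
    qed
    moreover have "(Suc k, k) \<in> fence_covers n" if "z \<le> k" "k < x" for k
      using that 2 step by (cases "k = z") auto
    ultimately show ?thesis using 2 by auto
  qed
qed

lemma partial_order_on_fence_le: "partial_order_on (fence_carrier n) (fence_le n)"
proof -
  have "x = y" if "(x, y) \<in> (fence_covers n)\<^sup>*" "(y, x) \<in> (fence_covers n)\<^sup>*" for x y
    using fence_covers_rtrancl[OF that(1)] fence_covers_rtrancl[OF that(2)] fence_covers_asym
    by (metis linorder_neqE_nat order_refl)
  then show ?thesis
    by (auto simp: partial_order_on_def preorder_on_def refl_on_def trans_def antisym_def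
        fence_le_def)
qed

lemma fence_covers_iff:
  "(x, y) \<in> fence_covers n \<longleftrightarrow>
     (x, y) \<in> fence_le n \<and> x \<noteq> y \<and>
     (\<forall>z. (x, z) \<in> fence_le n \<and> (z, y) \<in> fence_le n \<longrightarrow> z = x \<or> z = y)"
proof
  assume c: "(x, y) \<in> fence_covers n"
  have "z = x \<or> z = y" if "(x, z) \<in> (fence_covers n)\<^sup>*" "(z, y) \<in> (fence_covers n)\<^sup>*" for z
  proof (rule ccontr)
    assume n: "\<not> (z = x \<or> z = y)"
    note a = fence_covers_rtrancl[OF that(1)] fence_covers_rtrancl[OF that(2)]
    consider "z < x" "z < y" | "x < z" "y < z"
      using n fence_covers_adjacent[OF c] by linarith
    then show False
    proof cases
      case 1
      then show False using a fence_covers_asym by blast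
    next
      case 2
      then obtain k where "z = Suc k" "x \<le> k" "y \<le> k" by (cases z) auto
      then show False using a fence_covers_asym by (meson lessI)
    qed
  qed
  then show "(x, y) \<in> fence_le n \<and> x \<noteq> y \<and>
     (\<forall>z. (x, z) \<in> fence_le n \<and> (z, y) \<in> fence_le n \<longrightarrow> z = x \<or> z = y)"
    using c fence_covers_carrier[OF c] fence_covers_asym[of x x n] by (auto simp: fence_le_def)
next
  assume h: "(x, y) \<in> fence_le n \<and> x \<noteq> y \<and>
     (\<forall>z. (x, z) \<in> fence_le n \<and> (z, y) \<in> fence_le n \<longrightarrow> z = x \<or> z = y)"
  then obtain z where z: "(x, z) \<in> fence_covers n" "(z, y) \<in> (fence_covers n)\<^sup>*"
    by (auto simp: fence_le_def elim: converse_rtranclE)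
  then have "z = x \<or> z = y"
    using h fence_covers_carrier[OF z(1)] by (auto simp: fence_le_def)
  then show "(x, y) \<in> fence_covers n" using z fence_covers_asym by blast
qed

end

theory Submission imports Defs
begin

text \<open>
  Write \<open>h\<close> for the hyperbinary generating function. Removing the parts equal to 1 and halving
  the others gives \<open>h (2m + 1) = q h m\<close> and \<open>h (2m + 2) = h (m + 1) + q\<^sup>2 h m\<close>. On the other
  side, weight an ideal \<open>I\<close> of a fence with \<open>k\<close> elements by \<open>q ^ (k - |I|)\<close> and split the ideals
  of the fence of the whole word of \<open>m\<close> according to whether they contain its last element.
  Appending a digit acts linearly on the two resulting sums, and by induction on \<open>m\<close> these sums,
  multiplied by \<open>q\<close> to the number of ones, are \<open>h m\<close> and \<open>q\<^sup>2 h (m - 1)\<close>. They add up to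
  \<open>h (2m)\<close>, and the fence of \<open>2m\<close> is the one of the whole word of \<open>m\<close>; trailing ones only
  contribute factors \<open>q\<close>.
\<close>

section \<open>Hyperbinary partitions\<close>

text \<open>Inverse of removing the parts 1 and halving the rest: \<open>j\<close> is the
  multiplicity of the part 1.\<close>

definition double_parts :: "nat \<Rightarrow> nat multiset \<Rightarrow> nat multiset" where
  "double_parts j \<zeta> = replicate_mset j 1 + image_mset ((*) 2) \<zeta>"

lemma size_double_parts [simp]: "size (double_parts j \<zeta>) = j + size \<zeta>"
  by (simp add: double_parts_def)

lemma sum_double_parts: "sum_mset (double_parts j \<zeta>) = j + 2 * sum_mset \<zeta>"
  by (induction \<zeta>) (auto simp: double_parts_def)

lemma count_double_mset_even: "count (image_mset ((*) 2) \<zeta>) (2 * p) = count \<zeta> (p :: nat)"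
  by (induction \<zeta>) auto

lemma count_double_mset_odd: "odd p \<Longrightarrow> count (image_mset ((*) 2) \<zeta>) (p :: nat) = 0"
  by (auto simp: count_eq_zero_iff)

lemma count_double_parts:
  "count (double_parts j \<zeta>) p =
     (if p = 1 then j else if even p then count \<zeta> (p div 2) else 0)"
proof (cases "even p")
  case True
  then have "count (image_mset ((*) 2) \<zeta>) p = count \<zeta> (p div 2)"
    using count_double_mset_even[of \<zeta> "p div 2"] by simp
  with True show ?thesis by (auto simp: double_parts_def)
qed (simp add: double_parts_def count_double_mset_odd)

lemma inj_double_parts: "inj (double_parts j)"
proof (rule injI, rule multiset_eqI)
  fix \<zeta> \<xi> p assume "double_parts j \<zeta> = double_parts j \<xi>"
  \<comment> \<open>The number \<open>2 * p\<close> is never 1, so its multiplicity comes from the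
    doubled parts alone.\<close>
  then have "count (double_parts j \<zeta>) (2 * p) = count (double_parts j \<xi>) (2 * p)" by simp
  then show "count \<zeta> p = count \<xi> p" by (simp add: count_double_parts split: if_splits)
qed

lemma double_eq_power2: "(\<exists>k. 2 * p = 2 ^ k) \<longleftrightarrow> (\<exists>k. (p::nat) = 2 ^ k)"
proof -
  have "\<exists>k'. p = 2 ^ k'" if "2 * p = 2 ^ k" for k
  proof (cases k)
    case 0
    with that have "2 * p = 1" by simp
    then show ?thesis by presburger
  qed (use that in auto)
  moreover have "2 * p = 2 ^ Suc k" if "p = 2 ^ k" for k using that by simp
  ultimately show ?thesis by metis
qed

text \<open>Doubling preserves and reflects powers of 2 and multiplicities, so the only new
  constraint is the one on the multiplicity \<open>j\<close> of 1. The parity of \<open>N\<close>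
  then narrows down \<open>j\<close>.\<close>

lemma double_parts_in_hyperbinary_iff:
  "double_parts j \<zeta> \<in> hyperbinary_partitions N \<longleftrightarrow>
     j \<le> 2 \<and> (\<exists>m. N = j + 2 * m \<and> \<zeta> \<in> hyperbinary_partitions m)"
proof -
  have "(\<forall>p\<in>#double_parts j \<zeta>. \<exists>k. p = 2 ^ k) \<longleftrightarrow> (\<forall>p\<in>#\<zeta>. \<exists>k. p = 2 ^ k)"
    by (auto simp: double_parts_def double_eq_power2 intro: exI[of _ 0])
  moreover have "(\<forall>p. count (double_parts j \<zeta>) p \<le> 2) \<longleftrightarrow> j \<le> 2 \<and> (\<forall>p. count \<zeta> p \<le> 2)"
  proof safe
    assume *: "\<forall>p. count (double_parts j \<zeta>) p \<le> 2"
    show "j \<le> 2" using *[rule_format, of 1] by (simp add: count_double_parts)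
    show "count \<zeta> p \<le> 2" for p
      using *[rule_format, of "2 * p"] by (simp add: count_double_parts split: if_splits)
  qed (auto simp: count_double_parts)
  ultimately show ?thesis
    by (auto simp: hyperbinary_partitions_def sum_double_parts)
qed

lemma hyperbinary_is_double_parts:
  assumes "\<eta> \<in> hyperbinary_partitions N"
  obtains j \<zeta> where "\<eta> = double_parts j \<zeta>"
proof (rule that)
  have pow: "p = 1 \<or> even p" if "p \<in># \<eta>" for p
  proof -
    from assms have "\<forall>p\<in>#\<eta>. \<exists>k. p = 2 ^ k" by (simp add: hyperbinary_partitions_def)
    with that obtain k where "p = 2 ^ k" by blast
    then show ?thesis by (cases "k = 0") auto
  qed
  \<comment> \<open>A power of 2 other than 1 is even, so doubling undoes the halving.\<close>
  have "image_mset ((*) 2) (image_mset (\<lambda>p. p div 2) (filter_mset (\<lambda>p. p \<noteq> 1) \<eta>))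
      = image_mset id (filter_mset (\<lambda>p. p \<noteq> 1) \<eta>)"
    unfolding multiset.map_comp by (rule image_mset_cong) (auto dest!: pow)
  moreover have "filter_mset (\<lambda>p. p = 1) \<eta> = replicate_mset (count \<eta> 1) 1"
    by (simp add: filter_eq_replicate_mset)
  ultimately show "\<eta> = double_parts (count \<eta> 1)
      (image_mset (\<lambda>p. p div 2) (filter_mset (\<lambda>p. p \<noteq> 1) \<eta>))"
    unfolding double_parts_def using multiset_partition[of \<eta> "\<lambda>p. p = 1"] by simp
qed

lemma hyperbinary_partitions_odd:
  "hyperbinary_partitions (2 * m + 1) = double_parts 1 ` hyperbinary_partitions m"
proof (intro equalityI subsetI)
  fix \<eta> assume *: "\<eta> \<in> hyperbinary_partitions (2 * m + 1)"
  then obtain j \<zeta> where \<eta>: "\<eta> = double_parts j \<zeta>" by (rule hyperbinary_is_double_parts)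
  with * obtain m' where "j \<le> 2" "2 * m + 1 = j + 2 * m'" "\<zeta> \<in> hyperbinary_partitions m'"
    by (auto simp: double_parts_in_hyperbinary_iff)
  moreover from this have "j = 1" "m' = m" by presburger+
  ultimately show "\<eta> \<in> double_parts 1 ` hyperbinary_partitions m" using \<eta> by auto
qed (auto simp: double_parts_in_hyperbinary_iff)

lemma hyperbinary_partitions_even:
  "hyperbinary_partitions (2 * m + 2) =
     double_parts 0 ` hyperbinary_partitions (m + 1) \<union> double_parts 2 ` hyperbinary_partitions m"
proof (intro equalityI subsetI)
  fix \<eta> assume *: "\<eta> \<in> hyperbinary_partitions (2 * m + 2)"
  then obtain j \<zeta> where \<eta>: "\<eta> = double_parts j \<zeta>" by (rule hyperbinary_is_double_parts)
  with * obtain m' where "j \<le> 2" "2 * m + 2 = j + 2 * m'" "\<zeta> \<in> hyperbinary_partitions m'"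
    by (auto simp: double_parts_in_hyperbinary_iff)
  moreover from this have "j = 0 \<and> m' = m + 1 \<or> j = 2 \<and> m' = m" by presburger
  ultimately show "\<eta> \<in> double_parts 0 ` hyperbinary_partitions (m + 1) \<union>
      double_parts 2 ` hyperbinary_partitions m" using \<eta> by auto
qed (auto simp: double_parts_in_hyperbinary_iff intro!: exI[of _ "Suc m"])

lemma hyperbinary_partitions_0: "hyperbinary_partitions 0 = {{#}}"
proof -
  have "\<eta> = {#}" if "\<eta> \<in> hyperbinary_partitions 0" for \<eta>
  proof -
    \<comment> \<open>A zero sum forces every part to be 0, which is no power of 2.\<close>
    from that have "\<forall>p\<in>#\<eta>. p = 0" "\<forall>p\<in>#\<eta>. \<exists>k. p = 2 ^ k"
      by (auto simp: hyperbinary_partitions_def)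
    then show ?thesis by (cases \<eta>) auto
  qed
  then show ?thesis by (auto simp: hyperbinary_partitions_def)
qed

section \<open>Recurrences of the hyperbinary generating function\<close>

lemma hyperbinary_gf_0 [simp]: "hyperbinary_gf q 0 = 1"
  by (simp add: hyperbinary_gf_def hyperbinary_partitions_0)

lemma sum_size_double_parts:
  "(\<Sum>\<eta>\<in>double_parts j ` hyperbinary_partitions m. q ^ size \<eta>) = q ^ j * hyperbinary_gf q m"
  by (subst sum.reindex)
    (auto simp: hyperbinary_gf_def power_add sum_distrib_left
      intro: inj_on_subset[OF inj_double_parts])

lemma hyperbinary_gf_odd: "hyperbinary_gf q (2 * m + 1) = q * hyperbinary_gf q m"
  using sum_size_double_parts[of q 1 m] hyperbinary_partitions_odd[of m]
  by (simp add: hyperbinary_gf_def)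

lemma hyperbinary_gf_even:
  "hyperbinary_gf q (2 * m + 2) = hyperbinary_gf q (m + 1) + q ^ 2 * hyperbinary_gf q m"
proof -
  have "double_parts 0 \<zeta> \<noteq> double_parts 2 \<xi>" for \<zeta> \<xi>
  proof
    assume "double_parts 0 \<zeta> = double_parts 2 \<xi>"
    then have "count (double_parts 0 \<zeta>) 1 = count (double_parts 2 \<xi>) 1" by simp
    then show False by (simp add: count_double_parts)
  qed
  then have "double_parts 0 ` hyperbinary_partitions (m + 1) \<inter>
      double_parts 2 ` hyperbinary_partitions m = {}" by auto
  then have "hyperbinary_gf q (2 * m + 2) =
      (\<Sum>\<eta>\<in>double_parts 0 ` hyperbinary_partitions (m + 1). q ^ size \<eta>) +
      (\<Sum>\<eta>\<in>double_parts 2 ` hyperbinary_partitions m. q ^ size \<eta>)"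
    unfolding hyperbinary_gf_def hyperbinary_partitions_even
    by (intro sum.union_disjoint finite_imageI finite_hyperbinary_partitions)
  then show ?thesis by (simp only: sum_size_double_parts) simp
qed

section \<open>Binary words\<close>

lemma binary_word_0 [simp]: "binary_word 0 = []"
  by (simp add: binary_word.simps)

lemma binary_word_double: "m > 0 \<Longrightarrow> binary_word (2 * m) = binary_word m @ [0]"
  by (subst binary_word.simps) simp

lemma binary_word_double_plus_1: "binary_word (2 * m + 1) = binary_word m @ [1]"
  by (subst binary_word.simps) simp

lemma binary_word_digits: "set (binary_word n) \<subseteq> {0, 1}"
proof (induction n rule: binary_word.induct)
  case (1 n)
  then show ?case by (subst binary_word.simps) auto
qed

lemma length_binary_word_pos: "n > 0 \<Longrightarrow> length (binary_word n) > 0"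
  by (subst binary_word.simps) simp

lemma principal_prefix_snoc_0: "principal_prefix (w @ [0]) = w"
proof -
  have "Max {j. j < length (w @ [0]) \<and> (w @ [0]) ! j = 0} = length w"
    by (rule Max_eqI) auto
  then show ?thesis by (simp add: principal_prefix_def)
qed

lemma principal_prefix_snoc_1: "principal_prefix (w @ [1]) = principal_prefix w"
proof (cases "0 \<in> set w")
  case True
  have eq: "{j. j < length (w @ [1]) \<and> (w @ [1]) ! j = 0} = {j. j < length w \<and> w ! j = 0}"
    by (auto simp: nth_append split: if_splits)
  from True have "{j. j < length w \<and> w ! j = 0} \<noteq> {}" by (auto simp: in_set_conv_nth)
  \<comment> \<open>The rightmost 0 lies inside \<open>w\<close>, so \<open>take\<close> does not
    reach the appended digit.\<close>
  then have "Max {j. j < length w \<and> w ! j = 0} \<in> {j. j < length w \<and> w ! j = 0}"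
    by (intro Max_in) auto
  with True eq show ?thesis by (simp add: principal_prefix_def)
qed (simp add: principal_prefix_def)

lemma principal_prefix_eq_take: "\<exists>k. principal_prefix w = take k w"
  by (auto simp: principal_prefix_def intro: exI[of _ 0])

section \<open>Ideals of the fence of a word\<close>

text \<open>Stated for arbitrary words, so that digits can be appended one by one. Elements count
  from 1 and positions from 0, hence \<open>w ! i\<close> is the digit relating \<open>i\<close> and
  \<open>Suc i\<close>.\<close>

definition word_ideals :: "nat list \<Rightarrow> nat set set" where
  "word_ideals w = {I. I \<subseteq> {1..length w} \<and>
     (\<forall>i. 0 < i \<and> i < length w \<longrightarrow> (if w ! i = 0 then i \<in> I \<longrightarrow> Suc i \<in> I else Suc i \<in> I \<longrightarrow> i \<in> I))}"

lemma finite_word_ideals [simp]: "finite (word_ideals w)"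
  by (rule finite_subset[of _ "Pow {1..length w}"]) (auto simp: word_ideals_def)

text \<open>A set is closed under the order exactly when it is closed under the covers generating
  it.\<close>

lemma lower_order_ideals_fence:
  "lower_order_ideals (fence_carrier n) (fence_le n) = word_ideals (principal_prefix (binary_word n))"
proof -
  let ?w = "binary_word n" and ?p = "principal_prefix (binary_word n)"
  have nth: "?p ! i = ?w ! i" if "i < length ?p" for i
    using that principal_prefix_eq_take[of ?w] by auto
  \<comment> \<open>\<open>fence_covers\<close> tests for the digits 0 and 1, whereas
    \<open>word_ideals\<close> treats every nonzero digit alike; they agree on binary
    digits.\<close>
  have dig: "?w ! i = 0 \<or> ?w ! i = 1" if "i < length ?p" for i
  proof -
    have "i < length ?w" using that principal_prefix_eq_take[of ?w] by auto
    then show ?thesis using binary_word_digits[of n] nth_mem by blast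
  qed
  have down: "(\<forall>y\<in>I. \<forall>x\<in>fence_carrier n. (x, y) \<in> fence_le n \<longrightarrow> x \<in> I) \<longleftrightarrow>
      (\<forall>(x, y)\<in>fence_covers n. y \<in> I \<longrightarrow> x \<in> I)" if "I \<subseteq> fence_carrier n" for I
  proof
    assume "\<forall>y\<in>I. \<forall>x\<in>fence_carrier n. (x, y) \<in> fence_le n \<longrightarrow> x \<in> I"
    then show "\<forall>(x, y)\<in>fence_covers n. y \<in> I \<longrightarrow> x \<in> I"
      using fence_covers_carrier by (fastforce simp: fence_le_def)
  next
    assume *: "\<forall>(x, y)\<in>fence_covers n. y \<in> I \<longrightarrow> x \<in> I"
    have "x \<in> I" if "(x, y) \<in> (fence_covers n)\<^sup>*" "y \<in> I" for x y
      using that by (induction rule: converse_rtrancl_induct) (use * in auto)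
    then show "\<forall>y\<in>I. \<forall>x\<in>fence_carrier n. (x, y) \<in> fence_le n \<longrightarrow> x \<in> I"
      by (auto simp: fence_le_def)
  qed
  have covers: "(\<forall>(x, y)\<in>fence_covers n. y \<in> I \<longrightarrow> x \<in> I) \<longleftrightarrow>
      (\<forall>i. 0 < i \<and> i < length ?p \<longrightarrow> (if ?p ! i = 0 then i \<in> I \<longrightarrow> Suc i \<in> I else Suc i \<in> I \<longrightarrow> i \<in> I))"
    (is "?L \<longleftrightarrow> ?R") for I
  proof
    assume L: ?L
    show ?R
    proof (intro allI impI)
      fix i assume i: "0 < i \<and> i < length ?p"
      then have "?w ! i = 0 \<Longrightarrow> (Suc i, i) \<in> fence_covers n"
        and "?w ! i = 1 \<Longrightarrow> (i, Suc i) \<in> fence_covers n"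
        by (auto simp: fence_covers_def fence_carrier_def)
      with L i nth[of i] dig[of i]
      show "if ?p ! i = 0 then i \<in> I \<longrightarrow> Suc i \<in> I else Suc i \<in> I \<longrightarrow> i \<in> I" by auto
    qed
  next
    assume R: ?R
    show ?L
    proof clarify
      fix x y assume "(x, y) \<in> fence_covers n" "y \<in> I"
      then obtain i where i: "2 \<le> i" "i \<le> length ?p"
        "x = i \<and> y = i - 1 \<and> ?w ! (i - 1) = 0 \<or> x = i - 1 \<and> y = i \<and> ?w ! (i - 1) = 1"
        by (auto simp: fence_covers_def fence_carrier_def)
      then show "x \<in> I" using R[rule_format, of "i - 1"] nth[of "i - 1"] \<open>y \<in> I\<close> by auto
    qed
  qed
  show ?thesis
    unfolding lower_order_ideals_def word_ideals_def
    by (intro Collect_cong conj_cong)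
      (simp only: fence_carrier_def, rule trans[OF down covers], simp only: fence_carrier_def)
qed

text \<open>The new digit adds one element and one cover, joining it to \<open>length w\<close>.
  Nonemptiness of \<open>w\<close> makes \<open>length w\<close> an element of the old
  fence.\<close>

lemma word_ideals_snoc_iff:
  assumes "w \<noteq> []"
  shows "I \<in> word_ideals (w @ [d]) \<longleftrightarrow>
     I \<subseteq> {1..Suc (length w)} \<and> I - {Suc (length w)} \<in> word_ideals w \<and>
     (if d = 0 then length w \<in> I \<longrightarrow> Suc (length w) \<in> I else Suc (length w) \<in> I \<longrightarrow> length w \<in> I)"
proof -
  let ?l = "length w"
  let ?R = "\<lambda>c I i. if c = (0::nat) then i \<in> I \<longrightarrow> Suc i \<in> I else Suc i \<in> I \<longrightarrow> i \<in> I"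
  have "(\<forall>i. 0 < i \<and> i < length (w @ [d]) \<longrightarrow> ?R ((w @ [d]) ! i) I i) \<longleftrightarrow>
      (\<forall>i. 0 < i \<and> i < ?l \<longrightarrow> ?R ((w @ [d]) ! i) I i) \<and> ?R ((w @ [d]) ! ?l) I ?l"
    using assms unfolding length_append_singleton less_Suc_eq length_greater_0_conv[symmetric] by blast
  \<comment> \<open>The conditions at positions before \<open>?l\<close> mention only elements up to
    \<open>?l\<close>, so removing \<open>Suc ?l\<close> does not affect them.\<close>
  also have "(\<forall>i. 0 < i \<and> i < ?l \<longrightarrow> ?R ((w @ [d]) ! i) I i) \<longleftrightarrow>
      (\<forall>i. 0 < i \<and> i < ?l \<longrightarrow> ?R (w ! i) (I - {Suc ?l}) i)"
    by (intro all_cong) (simp add: nth_append)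
  finally have "(\<forall>i. 0 < i \<and> i < length (w @ [d]) \<longrightarrow> ?R ((w @ [d]) ! i) I i) \<longleftrightarrow>
      (\<forall>i. 0 < i \<and> i < ?l \<longrightarrow> ?R (w ! i) (I - {Suc ?l}) i) \<and> ?R d I ?l" by simp
  moreover have "I - {Suc ?l} \<subseteq> {1..?l} \<longleftrightarrow> I \<subseteq> {1..Suc ?l}"
    by (auto simp: subset_iff le_Suc_eq)
  ultimately show ?thesis
    unfolding word_ideals_def mem_Collect_eq by auto
qed

text \<open>An appended element is comparable by a cover only to the last one, so this dichotomy is
  all that the induction has to remember.\<close>

definition ideals_with_last :: "nat list \<Rightarrow> nat set set" where
  "ideals_with_last w = {I \<in> word_ideals w. length w \<in> I}"

definition ideals_without_last :: "nat list \<Rightarrow> nat set set" where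
  "ideals_without_last w = {I \<in> word_ideals w. length w \<notin> I}"

lemma finite_ideals_last [simp]: "finite (ideals_with_last w)" "finite (ideals_without_last w)"
  by (simp_all add: ideals_with_last_def ideals_without_last_def)

text \<open>After an appended 0 the new element lies below the old last one, so having it leaves the
  rest free; otherwise it lies above and forces the old last one into the ideal.\<close>

lemma ideals_with_last_snoc:
  assumes "w \<noteq> []"
  shows "ideals_with_last (w @ [d]) =
    insert (Suc (length w)) ` (if d = 0 then word_ideals w else ideals_with_last w)" (is "?L = ?R")
proof (intro equalityI subsetI)
  fix I assume "I \<in> ?L"
  then have "I = insert (Suc (length w)) (I - {Suc (length w)})"
    "I - {Suc (length w)} \<in> (if d = 0 then word_ideals w else ideals_with_last w)"
    by (auto simp: ideals_with_last_def word_ideals_snoc_iff[OF assms])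
  then show "I \<in> ?R" by blast
next
  fix I assume "I \<in> ?R"
  then obtain J where J: "I = insert (Suc (length w)) J"
    "J \<in> (if d = 0 then word_ideals w else ideals_with_last w)" by blast
  then have "J \<in> word_ideals w" by (auto simp: ideals_with_last_def split: if_splits)
  then have "J \<subseteq> {1..length w}" by (simp add: word_ideals_def)
  then have "insert (Suc (length w)) J - {Suc (length w)} = J" "J \<subseteq> {1..Suc (length w)}" by auto
  then have "insert (Suc (length w)) J \<in> ?L" using J(2) \<open>J \<in> word_ideals w\<close>
    by (simp add: ideals_with_last_def word_ideals_snoc_iff[OF assms] split: if_splits)
  then show "I \<in> ?L" by (simp only: J(1))
qed

text \<open>Dually, avoiding the new element excludes the old last one if the new one lies below it,
  and imposes nothing if it lies above.\<close>

lemma ideals_without_last_snoc: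
  assumes "w \<noteq> []"
  shows "ideals_without_last (w @ [d]) = (if d = 0 then ideals_without_last w else word_ideals w)"
proof -
  have "I - {Suc (length w)} = I" if "Suc (length w) \<notin> I" for I using that by simp
  moreover have "Suc (length w) \<notin> I \<and> I \<subseteq> {1..Suc (length w)}" if "I \<in> word_ideals w" for I
    using that by (fastforce simp: word_ideals_def)
  ultimately show ?thesis
    by (auto simp: ideals_without_last_def word_ideals_snoc_iff[OF assms])
qed

section \<open>Generating functions of complements of ideals\<close>

text \<open>With \<open>k\<close> the size of the fence, the exponent is the size of the complement
  of \<open>I\<close>. This weight avoids inverses of \<open>q\<close>, so the argument runs in any
  commutative semiring.\<close>

definition coideal_gf :: "'a::comm_semiring_1 \<Rightarrow> nat \<Rightarrow> nat set set \<Rightarrow> 'a" where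
  "coideal_gf q k S = (\<Sum>I\<in>S. q ^ (k - card I))"

lemma coideal_gf_word_ideals:
  "coideal_gf q k (word_ideals w) =
     coideal_gf q k (ideals_with_last w) + coideal_gf q k (ideals_without_last w)"
proof -
  have "word_ideals w = ideals_with_last w \<union> ideals_without_last w"
    "ideals_with_last w \<inter> ideals_without_last w = {}"
    by (auto simp: ideals_with_last_def ideals_without_last_def)
  then show ?thesis by (simp add: coideal_gf_def sum.union_disjoint)
qed

text \<open>Fence and ideal both gain one element, so complements keep their size.\<close>

lemma coideal_gf_insert:
  assumes "S \<subseteq> word_ideals w"
  shows "coideal_gf q (Suc (length w)) (insert (Suc (length w)) ` S) = coideal_gf q (length w) S"
proof -
  have sub: "I \<subseteq> {1..length w}" if "I \<in> S" for I using assms that by (auto simp: word_ideals_def)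
  then have nin: "Suc (length w) \<notin> I" if "I \<in> S" for I using that by fastforce
  have "inj_on (insert (Suc (length w))) S"
    by (rule inj_onI) (metis nin insert_ident)
  moreover have "card (insert (Suc (length w)) I) = Suc (card I)" if "I \<in> S" for I
    using nin[OF that] finite_subset[OF sub[OF that]] by simp
  ultimately show ?thesis by (simp add: coideal_gf_def sum.reindex)
qed

lemma card_word_ideal_le: "I \<in> word_ideals w \<Longrightarrow> card I \<le> length w"
  using card_mono[of "{1..length w}" I] by (auto simp: word_ideals_def)

lemma coideal_gf_Suc:
  assumes "S \<subseteq> word_ideals w"
  shows "coideal_gf q (Suc (length w)) S = q * coideal_gf q (length w) S"
  unfolding coideal_gf_def sum_distrib_left
proof (rule sum.cong)
  fix I assume "I \<in> S"
  \<comment> \<open>The truncated subtraction is exact because \<open>card I\<close> is at most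
    \<open>length w\<close>.\<close>
  then have "Suc (length w) - card I = Suc (length w - card I)"
    using assms card_word_ideal_le by (intro Suc_diff_le) auto
  then show "q ^ (Suc (length w) - card I) = q * q ^ (length w - card I)" by simp
qed simp

lemma word_ideals_Nil: "word_ideals [] = {{}}"
  by (auto simp: word_ideals_def)

lemma coideal_gf_singleton:
  "coideal_gf q 1 (ideals_with_last [d]) = 1" "coideal_gf q 1 (ideals_without_last [d]) = q"
proof -
  have "ideals_with_last [d] = {{1}}" "ideals_without_last [d] = {{}}"
    by (auto simp: ideals_with_last_def ideals_without_last_def word_ideals_def)
  then show "coideal_gf q 1 (ideals_with_last [d]) = 1" "coideal_gf q 1 (ideals_without_last [d]) = q"
    by (simp_all add: coideal_gf_def)
qed

text \<open>The transfer step: writing \<open>(A, B)\<close> for the sums with and without the last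
  element, the digit 0 yields \<open>(A + B, q * B)\<close> and any other digit yields
  \<open>(A, q * (A + B))\<close>.\<close>

lemma coideal_gf_snoc:
  assumes "w \<noteq> []"
  shows "coideal_gf q (length (w @ [d])) (ideals_with_last (w @ [d])) =
      coideal_gf q (length w) (if d = 0 then word_ideals w else ideals_with_last w)"
    and "coideal_gf q (length (w @ [d])) (ideals_without_last (w @ [d])) =
      q * coideal_gf q (length w) (if d = 0 then ideals_without_last w else word_ideals w)"
proof -
  have "word_ideals w \<subseteq> word_ideals w" "ideals_with_last w \<subseteq> word_ideals w"
    "ideals_without_last w \<subseteq> word_ideals w"
    by (auto simp: ideals_with_last_def ideals_without_last_def)
  note * = this[THEN coideal_gf_insert] this[THEN coideal_gf_Suc]
  show "coideal_gf q (length (w @ [d])) (ideals_with_last (w @ [d])) =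
      coideal_gf q (length w) (if d = 0 then word_ideals w else ideals_with_last w)"
    by (simp add: ideals_with_last_snoc[OF assms] *)
  show "coideal_gf q (length (w @ [d])) (ideals_without_last (w @ [d])) =
      q * coideal_gf q (length w) (if d = 0 then ideals_without_last w else word_ideals w)"
    by (simp add: ideals_without_last_snoc[OF assms] *)
qed

text \<open>The transfer step matches the recurrences: the first sum becomes \<open>h (2m)\<close>
  or \<open>h (2m + 1)\<close>, and the second becomes \<open>q\<^sup>2 h (2m - 1)\<close> or
  \<open>q\<^sup>2 h (2m)\<close>. For an appended 1 the count of ones supplies a further factor
  \<open>q\<close>.\<close>

lemma coideal_gf_binary_word:
  assumes "m > 0"
  defines "w \<equiv> binary_word m"
  shows "q ^ count_list w 1 * coideal_gf q (length w) (ideals_with_last w) = hyperbinary_gf q m \<and>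
    q ^ count_list w 1 * coideal_gf q (length w) (ideals_without_last w) =
      q ^ 2 * hyperbinary_gf q (m - 1)"
  using assms(1) unfolding w_def
proof (induction m rule: less_induct)
  case (less m)
  show ?case
  proof (cases "m = 1")
    case True
    moreover have "binary_word 1 = [1]" using binary_word_double_plus_1[of 0] by simp
    ultimately show ?thesis
      using coideal_gf_singleton[of q 1] hyperbinary_gf_odd[of q 0] by (simp add: power2_eq_square)
  next
    case False
    with less.prems obtain k where k: "m div 2 = Suc k" by (cases "m div 2") auto
    let ?w = "binary_word (Suc k)"
    let ?c = "q ^ count_list ?w 1"
    let ?A = "coideal_gf q (length ?w) (ideals_with_last ?w)"
    let ?B = "coideal_gf q (length ?w) (ideals_without_last ?w)"
    have IH: "?c * ?A = hyperbinary_gf q (Suc k)" "?c * ?B = q ^ 2 * hyperbinary_gf q k"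
      using less.IH[of "Suc k"] k by auto
    \<comment> \<open>This value serves twice: as \<open>h m\<close> when \<open>m\<close> is even
      and as \<open>h (m - 1)\<close> when \<open>m\<close> is odd.\<close>
    have even: "hyperbinary_gf q (2 * Suc k) = ?c * (?A + ?B)"
      using hyperbinary_gf_even[of q k] by (simp add: distrib_left IH[unfolded One_nat_def])
    have "?w \<noteq> []" using length_binary_word_pos[of "Suc k"] by auto
    note snoc = coideal_gf_snoc[OF this, of q]
    have "m = 2 * Suc k \<or> m = 2 * Suc k + 1" using k by presburger
    then show ?thesis
    proof
      assume m: "m = 2 * Suc k"
      have "hyperbinary_gf q (m - 1) = q * hyperbinary_gf q k"
        using hyperbinary_gf_odd[of q k] m by simp
      moreover have "binary_word m = ?w @ [0]"
        unfolding m by (rule binary_word_double) simp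
      moreover have "?c * (q * ?B) = q ^ 2 * (q * hyperbinary_gf q k)"
        unfolding mult.left_commute[of ?c] IH by (simp add: ac_simps)
      ultimately show ?thesis
        using even snoc[of 0] m by (simp add: coideal_gf_word_ideals)
    next
      assume m: "m = 2 * Suc k + 1"
      have "hyperbinary_gf q m = q * hyperbinary_gf q (Suc k)"
        unfolding m by (rule hyperbinary_gf_odd)
      moreover have "hyperbinary_gf q (m - 1) = ?c * (?A + ?B)"
        using even m by simp
      moreover have "binary_word m = ?w @ [1]"
        unfolding m by (rule binary_word_double_plus_1)
      ultimately show ?thesis
        using IH(1) snoc[of 1] by (simp add: coideal_gf_word_ideals power2_eq_square ac_simps)
    qed
  qed
qed

text \<open>The induction strips trailing ones, which leave the prefix alone. It stops at 0, where
  only the empty ideal exists, or at a positive even number, settled by adding the two sums for its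
  half.\<close>

lemma hyperbinary_gf_eq_coideal_gf:
  defines "p \<equiv> \<lambda>n. principal_prefix (binary_word n)"
  shows "hyperbinary_gf q n =
    q ^ count_list (binary_word n) 1 * coideal_gf q (length (p n)) (word_ideals (p n))"
proof (induction n rule: less_induct)
  case (less n)
  consider "n = 0" | k where "n = 2 * Suc k" | k where "n = 2 * k + 1"
  proof -
    have "n = 0 \<or> n = 2 * Suc (n div 2 - 1) \<or> n = 2 * (n div 2) + 1" by presburger
    then show ?thesis using that by blast
  qed
  then show ?case
  proof cases
    case 1
    then show ?thesis
      by (simp add: p_def principal_prefix_def coideal_gf_def word_ideals_Nil)
  next
    case (2 k)
    then have w: "binary_word n = binary_word (Suc k) @ [0]"
      by (simp only: binary_word_double zero_less_Suc)
    have "hyperbinary_gf q n = hyperbinary_gf q (Suc k) + q ^ 2 * hyperbinary_gf q k"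
      using hyperbinary_gf_even[of q k] 2 by simp
    with coideal_gf_binary_word[of "Suc k" q] show ?thesis
      by (simp add: p_def w principal_prefix_snoc_0 coideal_gf_word_ideals distrib_left)
  next
    case (3 k)
    then have "binary_word n = binary_word k @ [1]"
      by (simp only: binary_word_double_plus_1)
    moreover have "hyperbinary_gf q n = q * hyperbinary_gf q k"
      using 3 hyperbinary_gf_odd by blast
    ultimately show ?thesis
      using less.IH[of k] 3 principal_prefix_snoc_1[of "binary_word k"]
      by (simp add: p_def mult.assoc)
  qed
qed

section \<open>From complements of ideals to powers of the inverse\<close>

lemma power_mult_inverse_power:
  fixes x y :: "'a::comm_semiring_1"
  assumes "x * y = 1" and "c \<le> r"
  shows "x ^ r * y ^ c = x ^ (r - c)"
proof -
  have "x ^ r * y ^ c = x ^ (r - c) * (x * y) ^ c"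
    using assms(2) by (simp add: power_mult_distrib mult.assoc flip: power_add)
      (simp flip: mult.assoc power_add)
  then show ?thesis by (simp add: assms(1))
qed

theorem theorem3p17:
  fixes n r s :: nat
  assumes "r = length (principal_prefix (binary_word n))"
    and "s = count_list (binary_word n) 1"
  shows "hyperbinary_gf (fls_X :: int fls) n = fls_X ^ (r + s) * rgf n fls_X_inv"
proof -
  let ?W = "word_ideals (principal_prefix (binary_word n))"
  have "(fls_X :: int fls) * fls_X_inv = 1"
    by (simp add: fls_X_inv_times_conv_shift fls_X_conv_shift_1)
  note inverse = power_mult_inverse_power[OF this]
  have "fls_X ^ r * rgf n fls_X_inv = (\<Sum>I\<in>?W. fls_X ^ r * (fls_X_inv :: int fls) ^ card I)"
    by (simp add: rgf_def lower_order_ideals_fence sum_distrib_left)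
  \<comment> \<open>Each ideal has at most \<open>r\<close> elements, so the negative powers cancel
    termwise.\<close>
  also have "\<dots> = coideal_gf fls_X r ?W"
    unfolding coideal_gf_def assms(1)
    by (intro sum.cong refl inverse card_word_ideal_le)
  finally show ?thesis
    using hyperbinary_gf_eq_coideal_gf[of "fls_X :: int fls" n] assms
    by (simp add: power_add mult.assoc mult.left_commute)
qed

end
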